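(* Let $\alpha\in[0,1)$ and let $c_\alpha\in(0,\tfrac\pi2]$ be such that $\frac{\sin(2c_\alpha)}{2c_\alpha}=\alpha^2$. Let $(\mathbf u^n)_{0\le n\le M}$ be the solution of the discrete scheme $$\frac{\mathbf u^{n+1}-\mathbf u^n}{\Delta t}=-C\mathbf u^{n+1}-G(\mathbf u^n)D^{-2}\mathbf u^{n+1},\qquad 0\le n\le M-1,$$ and set $\mathbf u_\alpha^n:=D^{-\alpha}\mathbf u^n$. Assume $\|\mathbf u^0\|_\infty\le c_\alpha$. Then $$\|\mathbf u_\alpha^n\|_\infty\le\|\mathbf u_\alpha^0\|_\infty\quad\text{for all } 0\le n\le M.$$
   Context: Let $I=[0,1]$, $T>0$, and let $u_0:I\to\mathbb R$ with $u_0(0)=u_0(1)=0$. Let $N\in\mathbb N$, $h=\frac{1}{N+1}$, $x_i=ih$ for $0\le i\le N+1$, $M\in\mathbb N$, $\Delta t=\frac TM$. Define the $N\times N$ matrices $$A=\frac1{h^2}\mathrm{tridiag}(-1,2,-1),\quad B=\frac1{2h}\mathrm{tridiag}(-1,0,1),\quad D=\mathrm{diag}(x_1,\ldots,x_N),\quad C=A-D^{-1}B.$$ For $\mathbf u=(u_1,\ldots,u_N)^T\in\mathbb R^N$ let $G(\mathbf u)=\mathrm{diag}\big(\frac{\sin(2u_1)}{2u_1},\ldots,\frac{\sin(2u_N)}{2u_N}\big)$, with the convention that $\frac{\sin(2y)}{2y}=1$ at $y=0$. The starting vector of the scheme is $\mathbf u^0=(u_0(x_1),\ldots,u_0(x_N))^T$.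 $D^{-\alpha}=\mathrm{diag}(x_1^{-\alpha},\ldots,x_N^{-\alpha})$ and $\|\mathbf v\|_\infty=\max_i|v_i|$. *)

theory Defs
  imports Complex_Main "Jordan_Normal_Form.Matrix"
begin

text \<open>
  Vectors and matrices are indexed from 0 here, so the entry with index \<open>i < N\<close> belongs to the
  interior grid point \<open>x\<^sub>i\<^sub>+\<^sub>1 = (i + 1) h\<close>.
\<close>

definition mesh_size :: "nat \<Rightarrow> real" where
  "mesh_size N = 1 / (real N + 1)"

definition grid_pt :: "nat \<Rightarrow> nat \<Rightarrow> real" where
  "grid_pt N i = real i * mesh_size N"

text \<open>The three arguments are the sub-diagonal, diagonal and super-diagonal entries.\<close>

definition tridiag :: "nat \<Rightarrow> real \<Rightarrow> real \<Rightarrow> real \<Rightarrow> real mat" where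
  "tridiag N a b c = mat N N (\<lambda>(i, j).
     if i = Suc j then a else if i = j then b else if j = Suc i then c else 0)"

definition A_mat :: "nat \<Rightarrow> real mat" where
  "A_mat N = (1 / (mesh_size N)\<^sup>2) \<cdot>\<^sub>m tridiag N (-1) 2 (-1)"

definition B_mat :: "nat \<Rightarrow> real mat" where
  "B_mat N = (1 / (2 * mesh_size N)) \<cdot>\<^sub>m tridiag N (-1) 0 1"

definition D_mat :: "nat \<Rightarrow> real mat" where
  "D_mat N = mat_diag N (\<lambda>i. grid_pt N (Suc i))"

text \<open>Real powers of \<open>D\<close>; the diagonal entries of \<open>D\<close> are positive, so \<open>powr\<close> is the usual power.\<close>

definition D_pow :: "nat \<Rightarrow> real \<Rightarrow> real mat" where
  "D_pow N s = mat_diag N (\<lambda>i. grid_pt N (Suc i) powr s)"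

lemma grid_pt_pos: "0 < grid_pt N (Suc i)"
  by (simp add: grid_pt_def mesh_size_def)

lemma D_pow_one: "D_pow N 1 = D_mat N"
  using less_imp_le[OF grid_pt_pos] by (simp add: D_pow_def D_mat_def)

lemma D_pow_mult: "D_pow N s * D_pow N t = D_pow N (s + t)"
  by (simp add: D_pow_def powr_add)

lemma D_pow_zero: "D_pow N 0 = 1\<^sub>m N"
  using grid_pt_pos[of N, THEN less_imp_neq] by (auto simp: D_pow_def mat_diag_def)

lemma D_pow_dim: "dim_row (D_pow N s) = N"
  by (simp add: D_pow_def mat_diag_def)

lemma inverts_D_mat: "inverts_mat (D_mat N) (D_pow N (-1))" "inverts_mat (D_pow N (-1)) (D_mat N)"
  by (simp_all add: inverts_mat_def D_pow_one[symmetric] D_pow_mult D_pow_zero D_pow_dim)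

definition C_mat :: "nat \<Rightarrow> real mat" where
  "C_mat N = A_mat N - D_pow N (-1) * B_mat N"

definition G_mat :: "real vec \<Rightarrow> real mat" where
  "G_mat u = mat_diag (dim_vec u)
     (\<lambda>i. if u $ i = 0 then 1 else sin (2 * (u $ i)) / (2 * (u $ i)))"

definition start_vec :: "nat \<Rightarrow> (real \<Rightarrow> real) \<Rightarrow> real vec" where
  "start_vec N u0 = vec N (\<lambda>i. u0 (grid_pt N (Suc i)))"

text \<open>Only meaningful in positive dimension, as \<open>Max {}\<close> is unspecified.\<close>

definition max_norm :: "real vec \<Rightarrow> real" where
  "max_norm v = Max ((\<lambda>i. \<bar>v $ i\<bar>) ` {..<dim_vec v})"

definition scheme_solution ::
  "nat \<Rightarrow> nat \<Rightarrow> real \<Rightarrow> (real \<Rightarrow> real) \<Rightarrow> (nat \<Rightarrow> real vec) \<Rightarrow> bool" where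
  "scheme_solution N M T u0 u \<longleftrightarrow>
     (\<forall>n\<le>M. u n \<in> carrier_vec N) \<and>
     u 0 = start_vec N u0 \<and>
     (\<forall>n<M. (1 / (T / real M)) \<cdot>\<^sub>v (u (Suc n) - u n) =
        (- C_mat N) *\<^sub>v u (Suc n) - (G_mat (u n) * D_pow N (-2)) *\<^sub>v u (Suc n))"

end

theory Submission
  imports "HOL-Analysis.Generalised_Binomial_Theorem" Defs
begin

unbundle no vec_syntax

text \<open>
  Multiplied by \<open>h\<^sup>2\<close>, one step of the scheme reads, with \<open>\<lambda> = \<Delta>t / h\<^sup>2\<close> and
  \<open>g\<^sub>j = sin (2 u\<^sub>j\<^sup>n) / (2 u\<^sub>j\<^sup>n)\<close>,
  \<open>u\<^sub>j\<^sup>n\<^sup>+\<^sup>1 - u\<^sub>j\<^sup>n = \<lambda> ((1 + 1/(2j)) u\<^sub>j\<^sub>+\<^sub>1\<^sup>n\<^sup>+\<^sup>1 + (1 - 1/(2j)) u\<^sub>j\<^sub>-\<^sub>1\<^sup>n\<^sup>+\<^sup>1 - (2 + g\<^sub>j/j\<^sup>2) u\<^sub>j\<^sup>n\<^sup>+\<^sup>1)\<close>.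
  If \<open>g\<^sub>j \<ge> \<beta>\<^sup>2\<close>, then \<open>x\<^sub>j powr \<beta>\<close> is a supersolution of the stationary equation, and evaluating at a
  maximum of \<open>\<bar>u\<^sub>j\<^sup>n\<^sup>+\<^sup>1\<bar> / x\<^sub>j powr \<beta>\<close> shows that the maximum does not increase in the step. With
  \<open>\<beta> = 0\<close> this preserves \<open>\<bar>u\<^sup>n\<bar> \<le> c\<close>; as \<open>sin y / y\<close> decreases on \<open>[0, \<pi>]\<close>, that bound gives
  \<open>g\<^sub>j \<ge> \<alpha>\<^sup>2\<close>, so the step can be repeated with \<open>\<beta> = \<alpha>\<close>.
\<close>

section \<open>A power inequality from the binomial series\<close>

lemma gbinomial_Suc_eq: "a gchoose Suc n = (a gchoose n) * (a - real n) / (real n + 1)" for a :: real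
proof -
  have "(real n + 1) * (a gchoose Suc n) = (a - real n) * (a gchoose n)"
    using gbinomial_mult_1[of a n] by (simp add: algebra_simps)
  then show ?thesis by (simp add: field_simps)
qed

text \<open>From \<open>k\<close> to \<open>k + 1\<close> the factors \<open>a - (2 k + 1)\<close>
  and \<open>a - (2 k + 2)\<close> enter; both are nonpositive for \<open>a \<le> 1\<close>, so the
  sign persists.\<close>

lemma gbinomial_odd_nonneg:
  fixes a :: real
  assumes "0 \<le> a" "a \<le> 1"
  shows "0 \<le> a gchoose Suc (2 * k)"
proof (induction k)
  case (Suc k)
  have "a gchoose Suc (2 * Suc k) = (a gchoose Suc (2 * k))
      * ((a - real (Suc (2 * k))) * (a - real (Suc (Suc (2 * k)))))
      / ((real (Suc (2 * k)) + 1) * (real (Suc (Suc (2 * k))) + 1))"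
    by (simp only: mult_Suc_right add_2_eq_Suc gbinomial_Suc_eq[of a "Suc (Suc (2 * k))"]
      gbinomial_Suc_eq[of a "Suc (2 * k)"] times_divide_times_eq divide_divide_eq_left
      times_divide_eq_left mult.assoc)
  also have "\<dots> \<ge> 0"
    using Suc assms by (intro mult_nonneg_nonneg divide_nonneg_nonneg mult_nonpos_nonpos) auto
  finally show ?case .
qed (use assms in simp)

text \<open>
  In the binomial expansion of the left-hand side the odd powers of \<open>t\<close> cancel, the coefficient of
  \<open>t\<^sup>2\<close> is \<open>a\<^sup>2\<close>, and that of \<open>t ^ (2 k + 2)\<close> is
  \<open>(a gchoose (2 k + 1)) (a - k) / (k + 1)\<close>, which is nonpositive for \<open>k \<ge> 1\<close>.
\<close>

lemma weighted_powr_sum_le_lt_1: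
  fixes a t :: real
  assumes a: "0 \<le> a" "a \<le> 1" and t: "0 \<le> t" "t < 1"
  shows "(1 + t / 2) * (1 + t) powr a + (1 - t / 2) * (1 - t) powr a \<le> 2 + a\<^sup>2 * t\<^sup>2"
proof -
  define f where "f n = (1 + t / 2) * ((a gchoose n) * t ^ n) + (1 - t / 2) * ((a gchoose n) * (- t) ^ n)" for n
  let ?S = "(1 + t / 2) * (1 + t) powr a + (1 - t / 2) * (1 - t) powr a"
  have "f sums ?S"
    unfolding f_def
    using gen_binomial_real[of t a] gen_binomial_real[of "- t" a] t
    by (intro sums_add sums_mult) auto
  then have "(\<lambda>n. f (Suc n)) sums (?S - 2)"
    by (simp add: sums_Suc_iff) (simp add: f_def)
  \<comment> \<open>Grouped in pairs because \<open>f (2 k + 1)\<close> and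
    \<open>f (2 k + 2)\<close> both reduce to multiples of \<open>t ^ (2 k + 2)\<close>.\<close>
  then have "(\<lambda>k. sum (\<lambda>n. f (Suc n)) {k * 2..<k * 2 + 2}) sums (?S - 2)"
    by (rule sums_group) simp
  moreover have "(\<lambda>k. if k = 0 then a\<^sup>2 * t\<^sup>2 else 0) sums (a\<^sup>2 * t\<^sup>2)"
    using sums_single[of 0 "\<lambda>_. a\<^sup>2 * t\<^sup>2"] by simp
  moreover have "sum (\<lambda>n. f (Suc n)) {k * 2..<k * 2 + 2} \<le> (if k = 0 then a\<^sup>2 * t\<^sup>2 else 0)" for k
  proof -
    have even: "(- t) ^ (2 * k) = t ^ (2 * k)" by simp
    have "sum (\<lambda>n. f (Suc n)) {k * 2..<k * 2 + 2} = f (Suc (2 * k)) + f (Suc (Suc (2 * k)))"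
      by (simp add: numeral_2_eq_2 mult.commute)
    also have "\<dots> = ((a gchoose Suc (2 * k)) + 2 * (a gchoose Suc (Suc (2 * k)))) * t ^ (2 * k + 2)"
      by (simp only: f_def power_Suc power_add even) (simp add: algebra_simps power2_eq_square)
    also have "(a gchoose Suc (2 * k)) + 2 * (a gchoose Suc (Suc (2 * k)))
        = (a gchoose Suc (2 * k)) * ((a - k) / (real k + 1))"
      by (simp only: gbinomial_Suc_eq[of a "Suc (2 * k)"]) (simp add: field_simps)
    finally have eq: "sum (\<lambda>n. f (Suc n)) {k * 2..<k * 2 + 2}
        = (a gchoose Suc (2 * k)) * ((a - k) / (real k + 1)) * t ^ (2 * k + 2)" .
    show ?thesis
    proof (cases "k = 0")
      case True
      then show ?thesis unfolding eq by (simp add: power2_eq_square)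
    next
      case False
      then have "(a - k) / (real k + 1) \<le> 0"
        using a by (intro divide_nonpos_nonneg) auto
      then show ?thesis
        unfolding eq using False gbinomial_odd_nonneg[OF a, of k] t
        by (simp only: if_False) (intro mult_nonpos_nonneg mult_nonneg_nonpos zero_le_power)
    qed
  qed
  ultimately have "?S - 2 \<le> a\<^sup>2 * t\<^sup>2"
    by (rule sums_le[rotated])
  then show ?thesis by simp
qed

text \<open>
  The endpoint \<open>t = 1\<close> belongs to the grid point next to 0, whose left neighbour carries the weight
  \<open>0 powr a\<close>; this is 0 also for \<open>a = 0\<close>, so the left-hand side jumps there.
\<close>

lemma weighted_powr_sum_le:
  fixes a t :: real
  assumes a: "0 \<le> a" "a \<le> 1" and t: "0 \<le> t" "t \<le> 1"
  shows "(1 + t / 2) * (1 + t) powr a + (1 - t / 2) * (1 - t) powr a \<le> 2 + a\<^sup>2 * t\<^sup>2"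
proof (cases "t = 1")
  case True
  \<comment> \<open>The second summand may jump at 1, so it is dropped as nonnegative before
    \<open>s\<close> tends to 1.\<close>
  have "(1 + s / 2) * (1 + s) powr a \<le> 2 + a\<^sup>2 * s\<^sup>2" if "0 \<le> s" "s < 1" for s
  proof -
    have "0 \<le> (1 - s / 2) * (1 - s) powr a" using that by simp
    then show ?thesis using weighted_powr_sum_le_lt_1[OF a that] by linarith
  qed
  then have ev: "\<forall>\<^sub>F s in at_left 1. (1 + s / 2) * (1 + s) powr a \<le> 2 + a\<^sup>2 * s\<^sup>2"
    using eventually_at_left_real[of 0 "1::real"] by (auto elim!: eventually_mono)
  have "((\<lambda>s. (1 + s / 2) * (1 + s) powr a) \<longlongrightarrow> (1 + 1 / 2) * (1 + 1) powr a) (at_left (1::real))"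
    by (intro tendsto_intros) auto
  moreover have "((\<lambda>s. 2 + a\<^sup>2 * s\<^sup>2) \<longlongrightarrow> 2 + a\<^sup>2 * 1\<^sup>2) (at_left (1::real))"
    by (intro tendsto_intros)
  ultimately have "(1 + 1 / 2) * (1 + 1) powr a \<le> 2 + a\<^sup>2 * 1\<^sup>2"
    using ev by (intro tendsto_le[OF trivial_limit_at_left_real])
  then show ?thesis using True by simp
qed (use weighted_powr_sum_le_lt_1 assms in simp)

section \<open>Weighted maximum principle and concavity of the sine\<close>

text \<open>Where \<open>\<bar>v k\<bar> / \<omega> k\<close> attains its maximum \<open>m\<close>,
  the neighbours are at most \<open>m\<close> times their weights. By \<open>super\<close> they
  contribute at most \<open>\<kappa> * r k * \<bar>v k\<bar>\<close>, which cancels against the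
  implicit diagonal term.\<close>

lemma discrete_maximum_principle:
  fixes v y \<omega> p q r :: "nat \<Rightarrow> real"
  assumes bdry: "v 0 = 0" "v (Suc N) = 0" and \<kappa>: "\<kappa> \<ge> 0"
    and eq: "\<And>j. j \<in> {1..N} \<Longrightarrow> v j - y j = \<kappa> * (p j * v (Suc j) + q j * v (j - 1) - r j * v j)"
    and nonneg: "\<And>j. j \<in> {1..N} \<Longrightarrow> 0 \<le> p j \<and> 0 \<le> q j \<and> 0 \<le> r j"
    and \<omega>: "\<And>j. 0 \<le> \<omega> j" "\<And>j. j \<in> {1..N} \<Longrightarrow> 0 < \<omega> j"
    and super: "\<And>j. j \<in> {1..N} \<Longrightarrow> p j * \<omega> (Suc j) + q j * \<omega> (j - 1) \<le> r j * \<omega> j"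
    and bound: "\<And>j. j \<in> {1..N} \<Longrightarrow> \<bar>y j\<bar> \<le> K * \<omega> j"
    and i: "i \<in> {1..N}"
  shows "\<bar>v i\<bar> \<le> K * \<omega> i"
proof -
  define m where "m = Max ((\<lambda>j. \<bar>v j\<bar> / \<omega> j) ` {1..N})"
  have "m \<in> (\<lambda>j. \<bar>v j\<bar> / \<omega> j) ` {1..N}"
    unfolding m_def using i by (intro Max_in) auto
  then obtain k where k: "k \<in> {1..N}" "m = \<bar>v k\<bar> / \<omega> k" by auto
  have m0: "0 \<le> m" using k \<omega>(2)[of k] by simp
  have le_m: "\<bar>v j\<bar> / \<omega> j \<le> m" if "j \<in> {1..N}" for j
    unfolding m_def using that by (intro Max_ge) auto
  \<comment> \<open>A neighbour of \<open>k\<close> may be a boundary index. There \<open>v\<close>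
    vanishes, so \<open>\<omega>\<close> may be 0, as the weight \<open>x powr \<beta>\<close> is at
    the origin.\<close>
  have vm: "\<bar>v j\<bar> \<le> m * \<omega> j" if "j \<le> Suc N" for j
  proof (cases "j \<in> {1..N}")
    case True
    then show ?thesis using le_m[OF True] \<omega>(2)[OF True] by (simp add: pos_divide_le_eq)
  next
    case False
    then have "j = 0 \<or> j = Suc N" using that by auto
    then show ?thesis using bdry m0 \<omega>(1)[of j] by auto
  qed
  have vk: "\<bar>v k\<bar> = m * \<omega> k" using k \<omega>(2)[of k] by simp
  have nn: "0 \<le> p k" "0 \<le> q k" "0 \<le> r k" using nonneg[OF k(1)] by auto
  have "(1 + \<kappa> * r k) * \<bar>v k\<bar> = \<bar>(1 + \<kappa> * r k) * v k\<bar>"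
    using nn \<kappa> by (simp add: abs_mult)
  also have "(1 + \<kappa> * r k) * v k = y k + \<kappa> * (p k * v (Suc k) + q k * v (k - 1))"
    using eq[OF k(1)] by (simp add: algebra_simps)
  also have "\<bar>\<dots>\<bar> \<le> \<bar>y k\<bar> + \<kappa> * (p k * \<bar>v (Suc k)\<bar> + q k * \<bar>v (k - 1)\<bar>)"
  proof -
    have "\<bar>p k * v (Suc k) + q k * v (k - 1)\<bar> \<le> p k * \<bar>v (Suc k)\<bar> + q k * \<bar>v (k - 1)\<bar>"
      using abs_triangle_ineq[of "p k * v (Suc k)" "q k * v (k - 1)"] nn by (simp add: abs_mult)
    then have "\<bar>\<kappa> * (p k * v (Suc k) + q k * v (k - 1))\<bar> \<le> \<kappa> * (p k * \<bar>v (Suc k)\<bar> + q k * \<bar>v (k - 1)\<bar>)"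
      using \<kappa> by (simp add: abs_mult mult_left_mono)
    then show ?thesis by linarith
  qed
  also have "\<dots> \<le> K * \<omega> k + \<kappa> * (p k * (m * \<omega> (Suc k)) + q k * (m * \<omega> (k - 1)))"
    using bound[OF k(1)] k(1) nn \<kappa>
    by (intro add_mono mult_left_mono vm) auto
  also have "\<dots> = K * \<omega> k + \<kappa> * (m * (p k * \<omega> (Suc k) + q k * \<omega> (k - 1)))"
    by (simp add: algebra_simps)
  also have "\<dots> \<le> K * \<omega> k + \<kappa> * (m * (r k * \<omega> k))"
    using super[OF k(1)] m0 \<kappa> by (intro add_left_mono mult_left_mono)
  also have "\<dots> = K * \<omega> k + \<kappa> * r k * \<bar>v k\<bar>"
    by (simp add: vk)
  finally have "m * \<omega> k \<le> K * \<omega> k"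
    by (simp add: vk algebra_simps)
  then have "m \<le> K" using \<omega>(2)[OF k(1)] by simp
  then show ?thesis
    using vm[of i] i \<omega>(2)[OF i] by (meson atLeastAtMost_iff le_SucI less_imp_le mult_right_mono order_trans)
qed

text \<open>Concavity puts the sine above its chord from the origin. This is the monotonicity of
  \<open>sin y / y\<close>, stated so that \<open>x = 0\<close> is covered.\<close>

lemma sin_ge_chord:
  fixes x y :: real
  assumes "0 \<le> x" "x \<le> y" "0 < y" "y \<le> pi"
  shows "x * (sin y / y) \<le> sin x"
proof -
  have "concave_on {0..pi} sin"
    unfolding concave_on_def
    by (rule f''_ge0_imp_convex[where f' = "\<lambda>x. - cos x" and f'' = "\<lambda>x. sin x"])
      (auto intro!: derivative_eq_intros sin_ge_zero)
  from concave_onD[OF this, of "x / y" 0 y] show ?thesis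
    using assms by simp
qed

section \<open>From matrices to components\<close>

lemma max_norm_le_iff:
  assumes "v \<in> carrier_vec N" "N \<ge> 1"
  shows "max_norm v \<le> K \<longleftrightarrow> (\<forall>i<N. \<bar>v $ i\<bar> \<le> K)"
  using assms unfolding max_norm_def by (subst Max_le_iff) (auto simp: lessThan_empty_iff)

lemma mat_diag_mult_vec:
  fixes v :: "'a :: semiring_0 vec"
  assumes "v \<in> carrier_vec n" "i < n"
  shows "(mat_diag n f *\<^sub>v v) $ i = f i * v $ i"
proof -
  have "(\<Sum>j<n. (if i = j then f j else 0) * v $ j) = (\<Sum>j<n. if i = j then f j * v $ j else 0)"
    by (intro sum.cong) auto
  then show ?thesis
    using assms by (simp add: mat_diag_def scalar_prod_def atLeast0LessThan)
qed

text \<open>Indexed by grid points, so that the entry \<open>v $ (j - 1)\<close> is the value at \<open>grid_pt N j\<close>.\<close>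

definition zero_ext :: "nat \<Rightarrow> real vec \<Rightarrow> nat \<Rightarrow> real" where
  "zero_ext N v j = (if j \<in> {1..N} then v $ (j - 1) else 0)"

text \<open>The zero extension gives the first and last rows the same form as the others. Row
  \<open>i\<close> belongs to grid index \<open>i + 1\<close>, hence the shifted neighbours.\<close>

lemma tridiag_mult_vec:
  assumes "v \<in> carrier_vec N" "i < N"
  shows "(tridiag N a b c *\<^sub>v v) $ i
    = a * zero_ext N v i + b * zero_ext N v (Suc i) + c * zero_ext N v (Suc (Suc i))"
proof -
  \<comment> \<open>The guard \<open>i \<noteq> 0\<close> is needed because \<open>0 - 1 = 0\<close>
    on naturals.\<close>
  have "(\<Sum>j<N. (if i = Suc j then a else if i = j then b else if j = Suc i then c else 0) * v $ j)
     = (\<Sum>j<N. (if j = i - 1 \<and> i \<noteq> 0 then a * v $ j else 0)) + (\<Sum>j<N. (if j = i then b * v $ j else 0))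
     + (\<Sum>j<N. if j = Suc i then c * v $ j else 0)"
    unfolding sum.distrib[symmetric] by (intro sum.cong) auto
  also have "(\<Sum>j<N. (if j = i - 1 \<and> i \<noteq> 0 then a * v $ j else 0)) = a * zero_ext N v i"
    using assms by (cases "i = 0") (auto simp: zero_ext_def)
  also have "(\<Sum>j<N. (if j = i then b * v $ j else 0)) = b * zero_ext N v (Suc i)"
    using assms by (auto simp: zero_ext_def)
  also have "(\<Sum>j<N. if j = Suc i then c * v $ j else 0) = c * zero_ext N v (Suc (Suc i))"
    by (auto simp: zero_ext_def)
  finally show ?thesis
    using assms by (auto simp: tridiag_def scalar_prod_def atLeast0LessThan)
qed

text \<open>As \<open>x = j h\<close>, both the \<open>D\<close>-inverse drift term and the reaction
  term scale like \<open>1 / h\<^sup>2\<close>, so the bracketed weights depend only on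
  \<open>j\<close> and \<open>g\<close>.\<close>

lemma scheme_component:
  assumes sol: "scheme_solution N M T u0 u" and n: "n < M" and M: "M \<ge> 1" and T: "T > 0"
    and j: "j \<in> {1..N}"
  defines "g \<equiv> (if zero_ext N (u n) j = 0 then 1
    else sin (2 * zero_ext N (u n) j) / (2 * zero_ext N (u n) j))"
  shows "zero_ext N (u (Suc n)) j - zero_ext N (u n) j = T / real M * (real N + 1)\<^sup>2 *
    ((1 + 1 / (2 * real j)) * zero_ext N (u (Suc n)) (Suc j)
      + (1 - 1 / (2 * real j)) * zero_ext N (u (Suc n)) (j - 1)
      - (2 + g / (real j)\<^sup>2) * zero_ext N (u (Suc n)) j)"
proof -
  obtain i where i: "j = Suc i" "i < N" using j by (cases j) auto
  let ?v = "u (Suc n)" and ?y = "u n" and ?x = "grid_pt N (Suc i)" and ?h = "mesh_size N"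
  have v: "?v \<in> carrier_vec N" and y: "?y \<in> carrier_vec N"
    using sol n by (auto simp: scheme_solution_def)
  have tri: "tridiag N a b c \<in> carrier_mat N N" for a b c by (simp add: tridiag_def)
  have smult: "(k \<cdot>\<^sub>m X *\<^sub>v ?v) $ i = k * (X *\<^sub>v ?v) $ i" if "X \<in> carrier_mat N N" for k X
    using that v i by (simp add: scalar_prod_def sum_distrib_left mult.assoc)
  have A: "(A_mat N *\<^sub>v ?v) $ i = 1 / ?h\<^sup>2 *
      (2 * zero_ext N ?v j - zero_ext N ?v i - zero_ext N ?v (Suc j))"
    using smult[OF tri] tridiag_mult_vec[OF v i(2)] by (simp add: A_mat_def i)
  have B: "(B_mat N *\<^sub>v ?v) $ i = 1 / (2 * ?h) * (zero_ext N ?v (Suc j) - zero_ext N ?v i)"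
    using smult[OF tri] tridiag_mult_vec[OF v i(2)] by (simp add: B_mat_def i)
  have Ac: "A_mat N \<in> carrier_mat N N" and Bc: "B_mat N \<in> carrier_mat N N"
    by (simp_all add: A_mat_def B_mat_def tri)
  have Dc: "D_pow N s \<in> carrier_mat N N" for s by (simp add: D_pow_def)
  have Gc: "G_mat ?y \<in> carrier_mat N N" using y by (simp add: G_mat_def)
  have C: "(C_mat N *\<^sub>v ?v) $ i = (A_mat N *\<^sub>v ?v) $ i - ?x powr (-1) * (B_mat N *\<^sub>v ?v) $ i"
  proof -
    have "C_mat N *\<^sub>v ?v = A_mat N *\<^sub>v ?v - D_pow N (-1) *\<^sub>v (B_mat N *\<^sub>v ?v)"
      unfolding C_mat_def
      using minus_mult_distrib_mat_vec[OF Ac mult_carrier_mat[OF Dc Bc] v]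
        assoc_mult_mat_vec[OF Dc Bc v] by simp
    moreover have "(D_pow N (-1) *\<^sub>v (B_mat N *\<^sub>v ?v)) $ i = ?x powr (-1) * (B_mat N *\<^sub>v ?v) $ i"
      unfolding D_pow_def using mult_mat_vec_carrier[OF Bc v] i by (intro mat_diag_mult_vec)
    moreover have "dim_row (D_pow N (-1)) = N" by (rule carrier_matD[OF Dc])
    ultimately show ?thesis
      using i by (simp del: index_mult_mat_vec)
  qed
  have GD: "((G_mat ?y * D_pow N (-2)) *\<^sub>v ?v) $ i = g * (?x powr (-2) * ?v $ i)"
  proof -
    have "G_mat ?y * D_pow N (-2) = mat_diag N (\<lambda>i. (if ?y $ i = 0 then 1
        else sin (2 * ?y $ i) / (2 * ?y $ i)) * grid_pt N (Suc i) powr (-2))"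
      using y by (simp add: G_mat_def D_pow_def)
    then show ?thesis
      using v i by (simp add: mat_diag_mult_vec g_def zero_ext_def)
  qed
  have "((1 / (T / real M)) \<cdot>\<^sub>v (?v - ?y)) $ i
      = ((- C_mat N) *\<^sub>v ?v - (G_mat ?y * D_pow N (-2)) *\<^sub>v ?v) $ i"
    using sol n by (simp add: scheme_solution_def)
  moreover have Cc: "C_mat N \<in> carrier_mat N N"
    using Ac Bc Dc by (auto simp: C_mat_def intro!: minus_carrier_mat mult_carrier_mat)
  ultimately have "1 / (T / real M) * (?v $ i - ?y $ i)
      = - (C_mat N *\<^sub>v ?v) $ i - g * (?x powr (-2) * ?v $ i)"
    using v y i Gc Dc GD uminus_mult_mat_vec[of ?v "C_mat N"] by simp
  then have "?v $ i - ?y $ i = T / real M * (- (C_mat N *\<^sub>v ?v) $ i - g * (?x powr (-2) * ?v $ i))"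
    using T M by (simp add: field_simps)
  also have "- (C_mat N *\<^sub>v ?v) $ i - g * (?x powr (-2) * ?v $ i) = (real N + 1)\<^sup>2 *
    ((1 + 1 / (2 * real j)) * zero_ext N ?v (Suc j) + (1 - 1 / (2 * real j)) * zero_ext N ?v i
      - (2 + g / (real j)\<^sup>2) * ?v $ i)"
  proof -
    define H J where "H = real N + 1" and "J = real j"
    have h: "?h = 1 / H" and x: "?x = J / H" and pos: "H > 0" "J > 0"
      by (simp_all add: H_def J_def mesh_size_def grid_pt_def i)
    have "1 / ?h\<^sup>2 = H\<^sup>2" "1 / (2 * ?h) = H / 2" "?x powr (-1) = H / J" "?x powr (-2) = H\<^sup>2 / J\<^sup>2"
      unfolding h x using pos by (simp_all add: powr_minus power2_eq_square)
    moreover have "zero_ext N ?v j = ?v $ i" using i by (simp add: zero_ext_def)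
    ultimately show ?thesis
      unfolding C A B H_def[symmetric] J_def[symmetric] using pos
      by (simp only:) (simp add: field_simps power2_eq_square)
  qed
  finally show ?thesis
    using i by (simp add: zero_ext_def mult.assoc)
qed

section \<open>Propagating the bounds through the scheme\<close>

text \<open>The unweighted bound \<open>small\<close> controls \<open>g\<close>, while
  \<open>bound\<close> is the one propagated; keeping them apart lets \<open>\<beta>\<close> and
  \<open>K\<close> vary.\<close>

lemma scheme_step_bound:
  assumes sol: "scheme_solution N M T u0 u" and n: "n < M" and M: "M \<ge> 1" and T: "T > 0"
    and \<beta>: "0 \<le> \<beta>" "\<beta> \<le> 1" and c: "0 < c" "c \<le> pi / 2" "\<beta>\<^sup>2 \<le> sin (2 * c) / (2 * c)"
    and small: "\<And>j. \<bar>zero_ext N (u n) j\<bar> \<le> c"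
    and bound: "\<And>j. j \<in> {1..N} \<Longrightarrow> \<bar>zero_ext N (u n) j\<bar> \<le> K * grid_pt N j powr \<beta>"
    and j: "j \<in> {1..N}"
  shows "\<bar>zero_ext N (u (Suc n)) j\<bar> \<le> K * grid_pt N j powr \<beta>"
proof -
  define g where "g j = (if zero_ext N (u n) j = 0 then 1
    else sin (2 * zero_ext N (u n) j) / (2 * zero_ext N (u n) j))" for j
  have g: "\<beta>\<^sup>2 \<le> g j" for j
  proof (cases "zero_ext N (u n) j = 0")
    case True
    then show ?thesis using \<beta> by (simp add: g_def power_le_one)
  next
    case False
    let ?z = "\<bar>zero_ext N (u n) j\<bar>"
    \<comment> \<open>The quotient is even, so its argument may be taken positive;
      \<open>2 * c \<le> pi\<close> then admits the chord bound.\<close>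
    have "g j = sin (2 * ?z) / (2 * ?z)" using False by (simp add: g_def abs_if)
    moreover have "2 * ?z * (sin (2 * c) / (2 * c)) \<le> sin (2 * ?z)"
      using small[of j] c by (intro sin_ge_chord) auto
    ultimately have "sin (2 * c) / (2 * c) \<le> g j"
      using False by (simp add: pos_le_divide_eq mult.commute)
    then show ?thesis using c by linarith
  qed
  have grid: "0 < grid_pt N j" if "j \<in> {1..N}" for j
    using that grid_pt_pos[of N "j - 1"] by simp
  then have grid': "grid_pt N j \<noteq> 0" if "j \<in> {1..N}" for j
    using that by fastforce
  show ?thesis
  proof (rule discrete_maximum_principle[where N = N and y = "zero_ext N (u n)" and \<kappa> = "T / real M * (real N + 1)\<^sup>2"
        and p = "\<lambda>j. 1 + 1 / (2 * real j)" and q = "\<lambda>j. 1 - 1 / (2 * real j)"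
        and r = "\<lambda>j. 2 + g j / (real j)\<^sup>2"])
    fix k assume k: "k \<in> {1..N}"
    show "zero_ext N (u (Suc n)) k - zero_ext N (u n) k = T / real M * (real N + 1)\<^sup>2 *
      ((1 + 1 / (2 * real k)) * zero_ext N (u (Suc n)) (Suc k)
        + (1 - 1 / (2 * real k)) * zero_ext N (u (Suc n)) (k - 1)
        - (2 + g k / (real k)\<^sup>2) * zero_ext N (u (Suc n)) k)"
      using scheme_component[OF sol n M T k] by (simp only: g_def)
    have "0 \<le> g k" using g[of k] zero_le_power2[of \<beta>] by linarith
    then show "0 \<le> 1 + 1 / (2 * real k) \<and> 0 \<le> 1 - 1 / (2 * real k) \<and> 0 \<le> 2 + g k / (real k)\<^sup>2"
      using k by auto
    \<comment> \<open>The spacing relative to \<open>grid_pt N k\<close>: the neighbours are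
      \<open>1 + t\<close> and \<open>1 - t\<close> times this point, so its power factors
      out.\<close>
    define t where "t = 1 / real k"
    have t: "0 \<le> t" "t \<le> 1" using k by (auto simp: t_def)
    have "grid_pt N (Suc k) = (1 + t) * grid_pt N k" "grid_pt N (k - 1) = (1 - t) * grid_pt N k"
      using k by (simp_all add: grid_pt_def t_def algebra_simps of_nat_diff)
    then have up: "grid_pt N (Suc k) powr \<beta> = (1 + t) powr \<beta> * grid_pt N k powr \<beta>"
      and down: "grid_pt N (k - 1) powr \<beta> = (1 - t) powr \<beta> * grid_pt N k powr \<beta>"
      using t grid[OF k] by (simp_all add: powr_mult)
    have "(1 + t / 2) * (1 + t) powr \<beta> + (1 - t / 2) * (1 - t) powr \<beta> \<le> 2 + g k * t\<^sup>2"
      using weighted_powr_sum_le[OF \<beta> t] mult_right_mono[OF g[of k], of "t\<^sup>2"] by simp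
    from mult_right_mono[OF this, of "grid_pt N k powr \<beta>"]
    show "(1 + 1 / (2 * real k)) * grid_pt N (Suc k) powr \<beta> + (1 - 1 / (2 * real k)) * grid_pt N (k - 1) powr \<beta>
      \<le> (2 + g k / (real k)\<^sup>2) * grid_pt N k powr \<beta>"
      unfolding up down by (simp add: t_def power_divide algebra_simps)
  qed (use j T M bound grid' in \<open>auto simp: zero_ext_def\<close>)
qed

lemma max_norm_D_pow_le_iff:
  assumes "v \<in> carrier_vec N" "N \<ge> 1"
  shows "max_norm (D_pow N (- \<alpha>) *\<^sub>v v) \<le> K
    \<longleftrightarrow> (\<forall>j\<in>{1..N}. \<bar>zero_ext N v j\<bar> \<le> K * grid_pt N j powr \<alpha>)"
proof -
  have "D_pow N (- \<alpha>) *\<^sub>v v \<in> carrier_vec N"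
    using mult_mat_vec_carrier[of "D_pow N (- \<alpha>)" N N v] assms by (simp add: D_pow_def)
  then have "max_norm (D_pow N (- \<alpha>) *\<^sub>v v) \<le> K
      \<longleftrightarrow> (\<forall>i<N. grid_pt N (Suc i) powr (- \<alpha>) * \<bar>v $ i\<bar> \<le> K)"
    using assms by (auto simp: max_norm_le_iff D_pow_def mat_diag_mult_vec abs_mult)
  also have "\<dots> \<longleftrightarrow> (\<forall>i<N. \<bar>v $ i\<bar> \<le> K * grid_pt N (Suc i) powr \<alpha>)"
    using grid_pt_pos[of N, THEN less_imp_neq] by (auto simp: powr_minus divide_simps mult.commute)
  also have "\<dots> \<longleftrightarrow> (\<forall>j\<in>{1..N}. \<bar>zero_ext N v j\<bar> \<le> K * grid_pt N j powr \<alpha>)"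
    unfolding image_Suc_lessThan[symmetric] by (auto simp: zero_ext_def)
  finally show ?thesis .
qed

theorem lemma3p5:
  fixes N M :: nat and T \<alpha> c :: real and u0 :: "real \<Rightarrow> real" and u :: "nat \<Rightarrow> real vec"
  assumes "N \<ge> 1" and "M \<ge> 1" and "T > 0"
    and "u0 0 = 0" and "u0 1 = 0"
    and "0 \<le> \<alpha>" and "\<alpha> < 1"
    and "0 < c" and "c \<le> pi / 2" and "sin (2 * c) / (2 * c) = \<alpha>\<^sup>2"
    and "scheme_solution N M T u0 u"
    and "max_norm (u 0) \<le> c"
  shows "\<forall>n\<le>M. max_norm (D_pow N (- \<alpha>) *\<^sub>v u n) \<le> max_norm (D_pow N (- \<alpha>) *\<^sub>v u 0)"
proof -
  let ?K = "max_norm (D_pow N (- \<alpha>) *\<^sub>v u 0)"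
  have carrier: "u n \<in> carrier_vec N" if "n \<le> M" for n
    using assms(11) that by (simp add: scheme_solution_def)
  \<comment> \<open>Both bounds are carried along, since \<open>?K\<close> may exceed
    \<open>c\<close> and the weighted bound alone would not control \<open>g\<close> in the next
    step.\<close>
  have "(\<forall>j. \<bar>zero_ext N (u n) j\<bar> \<le> c) \<and>
      (\<forall>j\<in>{1..N}. \<bar>zero_ext N (u n) j\<bar> \<le> ?K * grid_pt N j powr \<alpha>)" if "n \<le> M" for n
    using that
  proof (induction n)
    case 0
    have "\<bar>zero_ext N (u 0) j\<bar> \<le> c" for j
      using assms(1,8,12) carrier[of 0] by (auto simp: zero_ext_def max_norm_le_iff)
    then show ?case
      using max_norm_D_pow_le_iff[OF carrier[of 0] assms(1), of \<alpha> ?K] by simp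
  next
    case (Suc n)
    then have n: "n < M" and small: "\<And>j. \<bar>zero_ext N (u n) j\<bar> \<le> c"
      and bound: "\<And>j. j \<in> {1..N} \<Longrightarrow> \<bar>zero_ext N (u n) j\<bar> \<le> ?K * grid_pt N j powr \<alpha>"
      by auto
    note step = scheme_step_bound[OF assms(11) n assms(2,3) _ _ assms(8,9) _ small]
    have "\<bar>zero_ext N (u (Suc n)) j\<bar> \<le> ?K * grid_pt N j powr \<alpha>" if "j \<in> {1..N}" for j
      using step[OF _ _ _ bound that] assms by simp
    moreover have "\<bar>zero_ext N (u (Suc n)) j\<bar> \<le> c" for j
    proof (cases "j \<in> {1..N}")
      case True
      \<comment> \<open>For \<open>\<beta> = 0\<close> the weight is 1 only at nonzero points, since
        \<open>0 powr 0 = 0\<close>.\<close>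
      have grid: "grid_pt N k \<noteq> 0" if "k \<in> {1..N}" for k
        using grid_pt_pos[of N "k - 1"] that by simp
      show ?thesis
        using step[of 0 c j] assms(10) True small grid by simp
    next
      case False
      then have "zero_ext N (u (Suc n)) j = 0" unfolding zero_ext_def by (rule if_not_P)
      then show ?thesis using assms(8) by simp
    qed
    ultimately show ?case by blast
  qed
  then show ?thesis
    using carrier max_norm_D_pow_le_iff[OF _ assms(1), of _ \<alpha> ?K] by blast
qed

end
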